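(* For any integer $d\ge 2$ and any $\alpha$ with $0<\alpha\le\frac12$, there is a real number $\beta=\beta(\alpha,d)\in(0,\alpha)$, depending only on $\alpha$ and $d$, such that any finite nonempty point set $P$ in $\mathbb{R}^d$ has an $(\alpha,\beta)$-core $\tilde{S}_\alpha(P)\subseteq\mathbb{R}^d$ which is a compact and convex set.
   Context: A $k$-flat in $\mathbb{R}^d$ is a translate of a $k$-dimensional linear subspace; hyperplanes are the $(d-1)$-flats. Let $\gamma\in(0,\frac12]$. A finite point set $P\subset\mathbb{R}^d$ is $\gamma$-split by a hyperplane $h$ if each of the two closed half-spaces bounded by $h$ contains at least $\gamma|P|$ points of $P$. For $0\le k\le d-1$, $P$ is $\gamma$-split by a $k$-flat $\tau$ if it is $\gamma$-split by every hyperplane that contains $\tau$. Let $P$ be a finite point set in $\mathbb{R}^d$ and $0<\beta\le\alpha\le\frac12$. A set $\tilde S\subseteq\mathbb{R}^d$ is an $(\alpha,\beta)$-core of $P$ if for every $0\le k\le d-1$ both conditions hold: (1) $\tilde S$ is intersected by every $k$-flat that $\alpha$-splits $P$; and (2) $P$ is $\beta$-split by every $k$-flat that intersects $\tilde S$. *)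

theory Defs
  imports "HOL-Analysis.Analysis"
begin

definition is_flat :: "nat \<Rightarrow> 'a::euclidean_space set \<Rightarrow> bool" where
  "is_flat k T \<longleftrightarrow> (\<exists>a V. subspace V \<and> dim V = k \<and> T = (+) a ` V)"

definition is_hyperplane :: "'a::euclidean_space set \<Rightarrow> bool" where
  "is_hyperplane h \<longleftrightarrow> is_flat (DIM('a) - 1) h"

text \<open>The pairs \<open>(u, c)\<close> and \<open>(-u, -c)\<close> describe the same hyperplane and yield its two
  closed half-spaces.\<close>

definition closed_halfspaces :: "'a::euclidean_space set \<Rightarrow> 'a set set" where
  "closed_halfspaces h =
     {{x. u \<bullet> x \<le> c} | u c. u \<noteq> 0 \<and> h = {x. u \<bullet> x = c}}"

definition split_by_hyperplane :: "real \<Rightarrow> 'a::euclidean_space set \<Rightarrow> 'a set \<Rightarrow> bool" where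
  "split_by_hyperplane \<gamma> P h \<longleftrightarrow>
     (\<forall>H \<in> closed_halfspaces h. real (card (P \<inter> H)) \<ge> \<gamma> * real (card P))"

definition split_by_flat :: "real \<Rightarrow> 'a::euclidean_space set \<Rightarrow> 'a set \<Rightarrow> bool" where
  "split_by_flat \<gamma> P T \<longleftrightarrow>
     (\<forall>h. is_hyperplane h \<and> T \<subseteq> h \<longrightarrow> split_by_hyperplane \<gamma> P h)"

text \<open>Only meaningful for finite \<open>P\<close> and \<open>0 < \<beta> \<le> \<alpha> \<le> 1/2\<close>; these conditions are left to
  the statements using it.\<close>

definition is_core :: "real \<Rightarrow> real \<Rightarrow> 'a::euclidean_space set \<Rightarrow> 'a set \<Rightarrow> bool" where
  "is_core \<alpha> \<beta> P S \<longleftrightarrow>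
     (\<forall>k \<le> DIM('a) - 1. \<forall>T. is_flat k T \<longrightarrow>
        (split_by_flat \<alpha> P T \<longrightarrow> T \<inter> S \<noteq> {}) \<and>
        (T \<inter> S \<noteq> {} \<longrightarrow> split_by_flat \<beta> P T))"

end

theory Submission
  imports Defs
begin

text \<open>The core is the set of points of Tukey depth at least \<open>\<beta>|P|\<close> for \<open>\<beta> = \<alpha> / (d + 1)\<close>,
  written as the intersection of the convex hulls of all subsets of \<open>P\<close> with more than
  \<open>(1 - \<beta>)|P|\<close> points. If a flat \<open>T\<close> \<open>\<alpha>\<close>-splits \<open>P\<close>, then any \<open>d + 1\<close> of these subsets have
  more than \<open>(1 - \<alpha>)|P|\<close> points in common, which is too many to lie strictly on one side of a
  hyperplane containing \<open>T\<close>; by separation the hull of the common points meets \<open>T\<close>, and Helly's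
  theorem applied to the traces of the hulls on \<open>T\<close> gives a point of the core on \<open>T\<close>.\<close>

text \<open>The complement in \<open>P\<close> of such a subset has fewer than \<beta>|P| points.
  The strict inequality matches depth at least \<beta>|P|: a closed half-space that fails this bound
  leaves a large subset outside it.\<close>

definition large_subsets :: "real \<Rightarrow> 'a set \<Rightarrow> 'a set set" where
  "large_subsets \<beta> P = {Q. Q \<subseteq> P \<and> real (card Q) > (1 - \<beta>) * real (card P)}"

definition deep_region :: "real \<Rightarrow> 'a::euclidean_space set \<Rightarrow> 'a set" where
  "deep_region \<beta> P = (\<Inter>Q \<in> large_subsets \<beta> P. convex hull Q)"

lemma finite_large_subsets: "finite P \<Longrightarrow> finite (large_subsets \<beta> P)"
  unfolding large_subsets_def by (rule finite_subset[of _ "Pow P"]) auto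

text \<open>Keeps the family of hulls nonempty; an empty intersection would be the whole space,
  which is not compact.\<close>

lemma self_in_large_subsets:
  assumes "finite P" "P \<noteq> {}" "0 < \<beta>"
  shows "P \<in> large_subsets \<beta> P"
proof -
  have "real (card P) > 0" using assms by (simp add: card_gt_0_iff)
  then show ?thesis
    using \<open>0 < \<beta>\<close> by (simp add: large_subsets_def)
qed

lemma compact_deep_region:
  assumes "finite P" "P \<noteq> {}" "0 < \<beta>"
  shows "compact (deep_region \<beta> P)"
  unfolding deep_region_def
proof (rule compact_Inter)
  show "\<And>K. K \<in> (hull) convex ` large_subsets \<beta> P \<Longrightarrow> compact K"
    using assms(1) by (auto simp: large_subsets_def intro!: finite_imp_compact_convex_hull
        dest: finite_subset)
  show "(hull) convex ` large_subsets \<beta> P \<noteq> {}"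
    using self_in_large_subsets[OF assms] by blast
qed

lemma convex_deep_region: "convex (deep_region \<beta> P)"
  unfolding deep_region_def by (simp add: convex_INT)

text \<open>Union bound on complements: each member misses fewer than \<beta>|P| points of
  \<open>P\<close>, so at most \<open>m\<close> members together miss fewer than
  m\<beta>|P|.\<close>

lemma large_subsets_Inter:
  assumes "finite P" and Q: "\<Q> \<subseteq> large_subsets \<beta> P" "\<Q> \<noteq> {}"
    and m: "card \<Q> \<le> m" and "0 \<le> \<beta>"
  shows "\<Inter>\<Q> \<in> large_subsets (real m * \<beta>) P"
proof -
  have fin: "finite \<Q>"
    using finite_large_subsets[OF \<open>finite P\<close>] Q(1) by (rule finite_subset[rotated])
  have sub: "\<Inter>\<Q> \<subseteq> P" using Q by (auto simp: large_subsets_def)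
  have each: "real (card (P - A)) < \<beta> * real (card P)" if "A \<in> \<Q>" for A
  proof -
    have A: "A \<subseteq> P" "real (card A) > (1 - \<beta>) * real (card P)"
      using that Q(1) by (auto simp: large_subsets_def)
    then have "real (card (P - A)) = real (card P) - real (card A)"
      using \<open>finite P\<close> by (simp add: card_Diff_subset finite_subset card_mono of_nat_diff)
    then show ?thesis using A(2) by (simp add: algebra_simps)
  qed
  have "P - \<Inter>\<Q> = (\<Union>A\<in>\<Q>. P - A)" by auto
  then have "real (card (P - \<Inter>\<Q>)) \<le> (\<Sum>A\<in>\<Q>. real (card (P - A)))"
    using card_UN_le[OF fin, of "\<lambda>A. P - A"] by (metis of_nat_mono of_nat_sum)
  also have "\<dots> < (\<Sum>A\<in>\<Q>. \<beta> * real (card P))"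
    using fin Q(2) each by (intro sum_strict_mono) auto
  also have "\<dots> = real (card \<Q>) * (\<beta> * real (card P))" by simp
  also have "\<dots> \<le> real m * (\<beta> * real (card P))"
    using m \<open>0 \<le> \<beta>\<close> by (intro mult_right_mono) auto
  finally have "real (card (P - \<Inter>\<Q>)) < real m * \<beta> * real (card P)" by (simp add: mult.assoc)
  moreover have "real (card (P - \<Inter>\<Q>)) = real (card P) - real (card (\<Inter>\<Q>))"
    using sub \<open>finite P\<close> by (simp add: card_Diff_subset finite_subset card_mono of_nat_diff)
  ultimately show ?thesis
    using sub by (simp add: large_subsets_def algebra_simps)
qed

text \<open>If a closed half-space \<open>H\<close> with \<open>x\<close> on its boundary held fewer
  than \<beta>|P| points, \<open>P - H\<close> would be a large subset inside the open complementary
  half-space, and its hull would miss \<open>x\<close>.\<close>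

lemma split_by_flat_if_meets_deep_region:
  assumes "finite P" and x: "x \<in> T" "x \<in> deep_region \<beta> P"
  shows "split_by_flat \<beta> P T"
  unfolding split_by_flat_def split_by_hyperplane_def
proof (intro allI impI ballI)
  fix h H
  assume "is_hyperplane h \<and> T \<subseteq> h" and "H \<in> closed_halfspaces h"
  then obtain u c where H: "H = {y. u \<bullet> y \<le> c}" and "u \<bullet> x = c"
    using x(1) by (auto simp: closed_halfspaces_def)
  show "real (card (P \<inter> H)) \<ge> \<beta> * real (card P)"
  proof (rule ccontr)
    assume "\<not> ?thesis"
    moreover have "real (card (P - H)) = real (card P) - real (card (P \<inter> H))"
      using \<open>finite P\<close> by (simp add: card_Diff_subset_Int card_mono)
    ultimately have "P - H \<in> large_subsets \<beta> P"
      by (simp add: large_subsets_def algebra_simps)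
    then have "x \<in> convex hull (P - H)" using x(2) by (auto simp: deep_region_def)
    moreover have "convex hull (P - H) \<subseteq> {y. u \<bullet> y > c}"
      by (rule hull_minimal) (auto simp: H convex_halfspace_gt)
    ultimately show False using \<open>u \<bullet> x = c\<close> by auto
  qed
qed

lemma is_hyperplane_normal:
  fixes u :: "'a::euclidean_space"
  assumes "u \<noteq> 0"
  shows "is_hyperplane {x. u \<bullet> x = c}"
proof -
  define a where "a = (c / (u \<bullet> u)) *\<^sub>R u"
  have a: "u \<bullet> a = c" using assms by (simp add: a_def)
  have "{x. u \<bullet> x = c} = (+) a ` {x. u \<bullet> x = 0}"
  proof (intro set_eqI iffI)
    fix x assume "x \<in> {x. u \<bullet> x = c}"
    then have "x - a \<in> {x. u \<bullet> x = 0}" using a by (simp add: inner_diff_right)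
    then show "x \<in> (+) a ` {x. u \<bullet> x = 0}" by (rule rev_image_eqI) simp
  qed (auto simp: inner_add_right a)
  then show ?thesis
    unfolding is_hyperplane_def is_flat_def
    using subspace_hyperplane dim_hyperplane[OF assms] by blast
qed

lemma halfspaces_of_normal:
  assumes "u \<noteq> 0"
  shows "{x. u \<bullet> x \<le> c} \<in> closed_halfspaces {x. u \<bullet> x = c}"
    and "{x. u \<bullet> x \<ge> c} \<in> closed_halfspaces {x. u \<bullet> x = c}"
proof -
  show "{x. u \<bullet> x \<le> c} \<in> closed_halfspaces {x. u \<bullet> x = c}"
    using assms by (auto simp: closed_halfspaces_def)
  have "{x. u \<bullet> x \<ge> c} = {x. (- u) \<bullet> x \<le> - c}" "{x. u \<bullet> x = c} = {x. (- u) \<bullet> x = - c}"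
    by auto
  then show "{x. u \<bullet> x \<ge> c} \<in> closed_halfspaces {x. u \<bullet> x = c}"
    using assms unfolding closed_halfspaces_def mem_Collect_eq
    by (intro exI[of _ "- u"] exI[of _ "- c"]) simp
qed

lemma convex_flat: "is_flat k T \<Longrightarrow> convex T"
  by (auto simp: is_flat_def intro: convex_translation subspace_imp_convex)

lemma closed_flat: "is_flat k T \<Longrightarrow> closed T"
  by (auto simp: is_flat_def intro: closed_translation closed_subspace)

text \<open>Along a line in \<open>T\<close> the functional is affine, so it is constant or takes
  every real value. This turns a hyperplane separating \<open>T\<close> from a set into a parallel
  one containing \<open>T\<close>.\<close>

lemma linear_bounded_below_on_flat:
  assumes T: "is_flat k T" "a \<in> T" and b: "\<And>x. x \<in> T \<Longrightarrow> u \<bullet> x > b"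
  shows "T \<subseteq> {x. u \<bullet> x = u \<bullet> a}"
proof
  fix x assume "x \<in> T"
  have line: "a + t *\<^sub>R (x - a) \<in> T" for t
  proof -
    obtain z V where V: "subspace V" "T = (+) z ` V" using T(1) by (auto simp: is_flat_def)
    then obtain v w where vw: "v \<in> V" "a = z + v" "w \<in> V" "x = z + w"
      using \<open>x \<in> T\<close> T(2) by auto
    then have "v + t *\<^sub>R (w - v) \<in> V"
      using V(1) by (simp add: subspace_add subspace_diff subspace_scale)
    then show ?thesis using V(2) vw by (auto simp: algebra_simps intro: rev_image_eqI)
  qed
  have "u \<bullet> (x - a) = 0"
  proof (rule ccontr)
    assume nz: "u \<bullet> (x - a) \<noteq> 0"
    \<comment> \<open>The parameter on the line through \<open>a\<close> and \<open>x\<close> at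
      which the functional equals \<open>b\<close>, against the strict bound.\<close>
    then have "u \<bullet> (a + ((b - u \<bullet> a) / (u \<bullet> (x - a))) *\<^sub>R (x - a)) = b"
      by (simp add: inner_add_right)
    then show False using b[OF line] by (metis less_irrefl)
  qed
  then show "x \<in> {x. u \<bullet> x = u \<bullet> a}" by (simp add: inner_diff_right)
qed

lemma split_flat_meets_hull:
  assumes "finite P" and T: "is_flat k T" "split_by_flat \<alpha> P T"
    and R: "R \<in> large_subsets \<alpha> P" "R \<noteq> {}"
  shows "T \<inter> convex hull R \<noteq> {}"
proof
  assume disj: "T \<inter> convex hull R = {}"
  have "R \<subseteq> P" using R by (auto simp: large_subsets_def)
  then have "finite R" using \<open>finite P\<close> finite_subset by blast
  obtain a where a: "a \<in> T"
    using T(1) subspace_0 by (fastforce simp: is_flat_def)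
  \<comment> \<open>The hull of a finite set is compact and a flat is closed, so the separation is
    strict on both sides.\<close>
  obtain u b where u: "\<And>x. x \<in> convex hull R \<Longrightarrow> u \<bullet> x < b" "\<And>x. x \<in> T \<Longrightarrow> u \<bullet> x > b"
    using separating_hyperplane_compact_closed[OF convex_convex_hull
        finite_imp_compact_convex_hull[OF \<open>finite R\<close>] _ convex_flat[OF T(1)] closed_flat[OF T(1)]]
      disj R(2) by (metis convex_hull_eq_empty inf_commute)
  \<comment> \<open>For \<open>u = 0\<close>, a point of \<open>R\<close> would give 0 < b and the
    point \<open>a\<close> would give 0 > b.\<close>
  have "u \<noteq> 0"
    using u(1) u(2)[OF a] R(2) hull_subset[of R convex] by fastforce
  define H where "H = {x. u \<bullet> x \<ge> u \<bullet> a}"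
  have "real (card (P \<inter> H)) \<ge> \<alpha> * real (card P)"
    using T(2) is_hyperplane_normal[OF \<open>u \<noteq> 0\<close>] linear_bounded_below_on_flat[OF T(1) a u(2)]
      halfspaces_of_normal(2)[OF \<open>u \<noteq> 0\<close>]
    unfolding split_by_flat_def split_by_hyperplane_def H_def by blast
  moreover have "card (P \<inter> H) + card R \<le> card P"
  proof -
    have "(P \<inter> H) \<inter> R = {}"
      using u(1) u(2)[OF a] hull_subset[of R convex] unfolding H_def by fastforce
    then have "card (P \<inter> H) + card R = card (P \<inter> H \<union> R)"
      using \<open>finite P\<close> \<open>finite R\<close> by (simp add: card_Un_disjoint)
    also have "\<dots> \<le> card P" using \<open>finite P\<close> \<open>R \<subseteq> P\<close> by (intro card_mono) auto
    finally show ?thesis .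
  qed
  \<comment> \<open>At least \<alpha>|P| points in \<open>H\<close> and more than (1 - \<alpha>)|P|
    in the disjoint set \<open>R\<close> exceed |P|.\<close>
  ultimately show False using R(1) by (simp add: large_subsets_def algebra_simps)
qed

lemma split_flat_meets_deep_region:
  fixes P :: "'a::euclidean_space set"
  assumes P: "finite P" "P \<noteq> {}" and "0 < \<alpha>" "\<alpha> \<le> 1"
    and T: "is_flat k T" "split_by_flat \<alpha> P T"
  shows "T \<inter> deep_region (\<alpha> / real (DIM('a) + 1)) P \<noteq> {}"
proof -
  define \<beta> where "\<beta> = \<alpha> / real (DIM('a) + 1)"
  have \<beta>: "0 < \<beta>" "real (DIM('a) + 1) * \<beta> = \<alpha>" using \<open>0 < \<alpha>\<close> by (auto simp: \<beta>_def field_simps)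
  define slice where "slice Q = T \<inter> convex hull Q" for Q
  define F where "F = slice ` large_subsets \<beta> P"
  have "F \<noteq> {}" unfolding F_def using self_in_large_subsets[OF P \<beta>(1)] by blast
  have few: "\<Inter>t \<noteq> {}" if "t \<subseteq> F" "t \<noteq> {}" "card t \<le> DIM('a) + 1" for t
  proof -
    \<comment> \<open>Different large subsets may have the same trace on \<open>T\<close>. One
      preimage per trace keeps the family as small as \<open>t\<close>.\<close>
    have "\<exists>\<Q>\<subseteq>large_subsets \<beta> P. inj_on slice \<Q> \<and> t = slice ` \<Q>"
      using that(1) unfolding F_def subset_image_inj .
    then obtain \<Q> where Q: "\<Q> \<subseteq> large_subsets \<beta> P" "inj_on slice \<Q>" "t = slice ` \<Q>"
      by (elim exE conjE)
    have "\<Q> \<noteq> {}" "card \<Q> \<le> DIM('a) + 1"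
      using that(2,3) unfolding Q(3) card_image[OF Q(2)] by auto
    then have "\<Inter>\<Q> \<in> large_subsets \<alpha> P"
      using large_subsets_Inter[OF P(1) Q(1) _ _ less_imp_le[OF \<beta>(1)], of "DIM('a) + 1"]
      unfolding \<beta>(2) by blast
    \<comment> \<open>Since \<alpha> \<le> 1, having more than (1 - \<alpha>)|P| points forces at
      least one.\<close>
    moreover from this have "\<Inter>\<Q> \<noteq> {}"
      using \<open>\<alpha> \<le> 1\<close> by (auto simp: large_subsets_def mult_less_0_iff)
    ultimately have "T \<inter> convex hull \<Inter>\<Q> \<noteq> {}"
      using split_flat_meets_hull[OF P(1) T] by blast
    moreover have "T \<inter> convex hull \<Inter>\<Q> \<subseteq> slice Q" if "Q \<in> \<Q>" for Q
      using hull_mono[of "\<Inter>\<Q>" Q convex] that by (auto simp: slice_def)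
    ultimately show ?thesis unfolding Q(3) by blast
  qed
  have "\<Inter>F \<noteq> {}"
  \<comment> \<open>Helly's theorem asks for at least d + 1 sets; a smaller family is handled by
    \<open>few\<close> applied to \<open>F\<close> itself.\<close>
  proof (cases "card F \<le> DIM('a) + 1")
    case True
    then show ?thesis using few \<open>F \<noteq> {}\<close> by blast
  next
    case False
    show ?thesis
    proof (rule Helly)
      show "DIM('a) + 1 \<le> card F" using False by simp
      show "\<forall>s\<in>F. convex s"
        using convex_flat[OF T(1)] by (auto simp: F_def slice_def convex_Int)
      show "\<Inter>t \<noteq> {}" if "t \<subseteq> F" "card t = DIM('a) + 1" for t
        using few[of t] that by fastforce
    qed
  qed
  moreover have "\<Inter>F \<subseteq> T \<inter> deep_region \<beta> P"
    using self_in_large_subsets[OF P \<beta>(1)] by (auto simp: F_def slice_def deep_region_def)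
  ultimately show ?thesis unfolding \<beta>_def by blast
qed

theorem lemma3p1:
  fixes \<alpha> :: real
  assumes "CARD('n::finite) \<ge> 2"
    and "0 < \<alpha>" and "\<alpha> \<le> 1/2"
  shows "\<exists>\<beta>. 0 < \<beta> \<and> \<beta> < \<alpha> \<and>
           (\<forall>P :: (real ^ 'n) set. finite P \<and> P \<noteq> {} \<longrightarrow>
              (\<exists>S. is_core \<alpha> \<beta> P S \<and> compact S \<and> convex S))"
proof -
  \<comment> \<open>The divisor d + 1 is the Helly number of the space: d + 1 losses of less than
    \<beta>|P| points add up to less than \<alpha>|P|.\<close>
  define \<beta> where "\<beta> = \<alpha> / real (DIM(real ^ 'n) + 1)"
  have \<beta>: "0 < \<beta>" "\<beta> < \<alpha>" using assms by (auto simp: \<beta>_def field_simps)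
  have "is_core \<alpha> \<beta> P (deep_region \<beta> P)" if "finite P" "P \<noteq> {}" for P :: "(real ^ 'n) set"
    unfolding is_core_def
  proof (intro allI impI conjI)
    fix k and T :: "(real ^ 'n) set"
    assume T: "is_flat k T"
    show "T \<inter> deep_region \<beta> P \<noteq> {}" if "split_by_flat \<alpha> P T"
      using split_flat_meets_deep_region[OF \<open>finite P\<close> \<open>P \<noteq> {}\<close> \<open>0 < \<alpha>\<close> _ T that] assms(3)
      unfolding \<beta>_def by linarith
    show "split_by_flat \<beta> P T" if "T \<inter> deep_region \<beta> P \<noteq> {}"
      using that split_by_flat_if_meets_deep_region[OF \<open>finite P\<close>] by blast
  qed
  then have "\<exists>S. is_core \<alpha> \<beta> P S \<and> compact S \<and> convex S"
    if "finite P" "P \<noteq> {}" for P :: "(real ^ 'n) set"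
    using compact_deep_region[OF that \<beta>(1)] convex_deep_region[of \<beta> P] that by blast
  then show ?thesis
    using \<beta> by (intro exI[of _ \<beta>]) simp
qed

end
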